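(* Let $\alpha,\beta>0$ be real numbers with $\alpha\beta=1/36$. Then $$\sqrt{\alpha}\left\{\phi_{\alpha}\left(\tfrac{i}{2}\right)\right\}^2-2\sqrt{\alpha}\,\phi_{\alpha}\big(\tfrac{i}{6}\big)\phi_{\alpha}\big(\tfrac{5i}{6}\big)= \sqrt{\beta}\left\{\phi_{\beta}\left(\tfrac{i}{2}\right)\right\}^2-2\sqrt{\beta}\,\phi_{\beta}\big(\tfrac{i}{6}\big)\phi_{\beta}\big(\tfrac{5i}{6}\big).$$
   Context: For $\alpha>0$ and $\theta\in\mathbb{C}$ define the one-dimensional Mordell integral $$\phi_\alpha(\theta)=\int_0^\infty\frac{\cos(\pi \theta x)}{\cosh \pi x}\,e^{-\pi \alpha x^2}\,dx ,$$ so that $\phi_\alpha(is)=\int_0^\infty\frac{\cosh(\pi s x)}{\cosh\pi x}e^{-\pi\alpha x^2}dx$ for real $s$. *)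

theory Defs
  imports "HOL-Analysis.Analysis"
begin

definition mordell_phi :: "real \<Rightarrow> complex \<Rightarrow> complex" where
  "mordell_phi \<alpha> \<theta> =
     (LBINT x:{0..}. cos (of_real pi * \<theta> * of_real x) / of_real (cosh (pi * x)) *
        of_real (exp (- pi * \<alpha> * x\<^sup>2)))"

end

(* With g_s(x) = cosh(pi s x)/cosh(pi x), a rectangle contour gives the Fourier transform
   g_s^(t) = 2 cos(pi s/2) cosh(pi t)/(cos(pi s) + cosh(2 pi t)).  Since the Gaussian is
   self-dual, Parseval turns sqrt(alpha) int g_s(x) exp(-pi alpha x^2) dx into
   1/6 int g_s^(x/6) exp(-pi beta x^2) dx when alpha beta = 1/36.  For s = 1/2, 1/6, 5/6 the
   functions g_s^(x/6) are linear combinations of g_{1/2}, g_{1/6}, g_{5/6} again, because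
   cosh(pi x) = C (4 C^2 - 3) with C = cosh(pi x/3).  So the alpha-integrals are linear in the
   beta-integrals, and the quadratic form G(1/2)^2 - 2 G(1/6) G(5/6) is preserved up to the
   scaling. *)
theory Submission
  imports Defs "HOL-Complex_Analysis.Complex_Analysis" "HOL-Probability.Probability"
begin

section \<open>Integrability of exponentials divided by cosh\<close>

lemma exp_div_cosh_bound:
  fixes a x :: real
  shows "exp (pi * a * x) / cosh (pi * x) \<le> 2 * exp (- (pi * (1 - \<bar>a\<bar>) * \<bar>x\<bar>))"
proof -
  have "a * x \<le> \<bar>a\<bar> * \<bar>x\<bar>"
    by (metis abs_ge_self abs_mult)
  then have "exp (pi * a * x) \<le> exp (pi * \<bar>a\<bar> * \<bar>x\<bar>)"
    by (simp add: mult.assoc)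
  moreover have "cosh (pi * x) \<ge> exp (pi * \<bar>x\<bar>) / 2"
    by (cases "x \<ge> 0") (auto simp: cosh_field_def field_simps)
  ultimately have "exp (pi * a * x) / cosh (pi * x) \<le> exp (pi * \<bar>a\<bar> * \<bar>x\<bar>) / (exp (pi * \<bar>x\<bar>) / 2)"
    by (intro frac_le) auto
  also have "\<dots> = 2 * exp (- (pi * (1 - \<bar>a\<bar>) * \<bar>x\<bar>))"
    by (simp add: exp_minus exp_diff[symmetric] field_simps flip: exp_add)
  finally show ?thesis .
qed

lemma integrable_exp_abs:
  fixes c :: real
  assumes "c > 0"
  shows "integrable lborel (\<lambda>x::real. exp (- (c * \<bar>x\<bar>)))"
proof -
  have "integrable lborel (\<lambda>x. indicator {0<..} x *\<^sub>R exp (- (x * c)))"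
    using integrable_I0i_exp_mscale[OF assms] by (simp add: set_integrable_def)
  then have "integrable lborel (\<lambda>x. indicator {0..} x *\<^sub>R exp (- (c * \<bar>x\<bar>)))"
    \<comment> \<open>The known integral is over the open half-line, while the extension by evenness
      starts from \<open>{0..}\<close>; the two integrands differ only at the null point 0.\<close>
    by (rule integrable_cong_AE_imp) (use AE_lborel_singleton[of 0] in \<open>auto split: split_indicator simp: mult.commute\<close>)
  then have "has_bochner_integral lborel (\<lambda>x. indicator {0..} x *\<^sub>R exp (- (c * \<bar>x\<bar>)))
      (LBINT x. indicator {0..} x *\<^sub>R exp (- (c * \<bar>x\<bar>)))"
    by (rule has_bochner_integral_integrable)
  from has_bochner_integral_even_function[OF this] show ?thesis
    by (auto simp: has_bochner_integral_iff)
qed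

lemma integrable_exp_div_cosh:
  fixes a :: real
  assumes "\<bar>a\<bar> < 1"
  shows "integrable lborel (\<lambda>x::real. exp (pi * a * x) / cosh (pi * x))"
proof (rule Bochner_Integration.integrable_bound)
  show "integrable lborel (\<lambda>x::real. 2 * exp (- (pi * (1 - \<bar>a\<bar>) * \<bar>x\<bar>)))"
    using integrable_exp_abs[of "pi * (1 - \<bar>a\<bar>)"] assms by simp
qed (use exp_div_cosh_bound[of a] in \<open>auto simp: cosh_field_def\<close>)

text \<open>For real \<open>x\<close> the denominator is real and positive, and only
  \<open>Re w\<close> affects the modulus of the numerator. Integrability for complex
  \<open>w\<close> thus reduces to the real exponent \<open>Re w\<close>.\<close>

lemma norm_exp_div_cosh:
  "norm (exp (of_real pi * w * of_real x) / cosh (of_real (pi * x) :: complex))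
     = exp (pi * Re w * x) / cosh (pi * x)"
proof -
  have "cosh (of_real (pi * x) :: complex) = of_real (cosh (pi * x))"
    by (simp add: cosh_field_def flip: exp_of_real)
  then show ?thesis
    by (simp add: norm_divide norm_exp_eq_Re del: of_real_mult)
qed

lemma integrable_cexp_div_cosh:
  assumes "\<bar>Re w\<bar> < 1"
  shows "integrable lborel (\<lambda>x::real. exp (of_real pi * w * of_real x) / cosh (of_real (pi * x) :: complex))"
proof (rule Bochner_Integration.integrable_bound)
  show "integrable lborel (\<lambda>x::real. exp (pi * Re w * x) / cosh (pi * x))"
    using assms by (rule integrable_exp_div_cosh)
  show "(\<lambda>x::real. exp (of_real pi * w * of_real x) / cosh (of_real (pi * x) :: complex)) \<in> borel_measurable lborel"
    unfolding cosh_field_def by measurable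
qed (simp add: norm_exp_div_cosh del: of_real_mult)

section \<open>Contour evaluation of the exponential integral\<close>

lemma norm_cosh_ge: "norm (cosh z) \<ge> \<bar>sinh (Re z)\<bar>" for z :: complex
proof -
  have "\<bar>norm (exp z) - norm (- exp (-z))\<bar> \<le> norm (exp z - (- exp (-z)))"
    by (rule norm_triangle_ineq3)
  then show ?thesis
    by (simp add: cosh_field_def sinh_field_def norm_divide)
qed

text \<open>The zeros of cosh (pi z) are the points i (n + 1/2) with n an integer. The open strip
  contains every rectangle with 0 \<le> Im z \<le> 1 and stops short of the neighbouring zeros -i/2
  and 3i/2.\<close>

lemma cosh_pi_eq_0_strip:
  assumes "cosh (of_real pi * z) = 0" "- (1/2) < Im z" "Im z < 3/2"
  shows "z = \<i> / 2"
proof -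
  let ?z = "of_real pi * z"
  have "exp (2 * ?z) = - 1"
  proof -
    have "exp ?z + exp (- ?z) = 0"
      using assms(1) by (simp add: cosh_field_def)
    then have "exp ?z * (exp ?z + exp (- ?z)) = 0"
      by simp
    then show ?thesis
      by (simp add: distrib_left mult_exp_exp eq_neg_iff_add_eq_0 mult.commute)
  qed
  then have "exp (2 * ?z) = exp (\<i> * of_real pi)"
    by (simp add: exp_pi_i')
  then obtain n :: int where "2 * ?z = \<i> * of_real pi + of_int (2 * n) * of_real pi * \<i>"
    unfolding exp_eq by auto
  then have "of_real (2 * pi) * z = of_real (2 * pi) * ((\<i> / 2) + of_int n * \<i>)"
    by (simp add: field_simps)
  then have z: "z = \<i> / 2 + of_int n * \<i>"
    by (subst (asm) mult_cancel_left) auto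
  with assms have "n = 0"
    by auto
  with z show ?thesis by simp
qed

text \<open>The rectangle with corners -r, r, r + i, -r + i encloses the single simple pole i/2,
  whose residue accounts for the term 2 exp (i pi w / 2). The top side contributes exp (i pi w)
  times the bottom side, and the two vertical sides make up the error. The error bound tends to 0 as
  r grows only if |Re w| < 1, which is imposed later.\<close>

lemma rectangle_integral_exp_div_cosh:
  fixes w :: complex and r :: real
  defines "f \<equiv> (\<lambda>z. exp (of_real pi * w * z) / cosh (of_real pi * z))"
  assumes r: "r > 0"
  shows "norm ((1 + exp (\<i> * of_real pi * w)) * integral {-r..r} (\<lambda>x. f (of_real x)) - 2 * exp (\<i> * of_real pi * w / 2))
     \<le> 2 * (exp (pi * (\<bar>Re w\<bar> * r + \<bar>Im w\<bar>)) / sinh (pi * r))"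
proof -
  define S where "S = {z. - (1/2) < Im z} \<inter> {z. Im z < 3/2}"
  define R where "R = rectpath (- of_real r) (of_real r + \<i>)"
  define I where "I = integral {-r..r} (\<lambda>x. f (of_real x))"
  define B where "B = exp (pi * (\<bar>Re w\<bar> * r + \<bar>Im w\<bar>)) / sinh (pi * r)"
  have S: "open S" "connected S"
    unfolding S_def
     apply (intro open_Int open_halfspace_Im_gt open_halfspace_Im_lt)
    apply (intro convex_connected convex_Int convex_halfspace_Im_gt convex_halfspace_Im_lt)
    done
  have nz: "cosh (of_real pi * z) \<noteq> 0" if "z \<in> S - {\<i> / 2}" for z
    using that cosh_pi_eq_0_strip[of z] by (auto simp: S_def)
  have cosh_holo: "(\<lambda>z. cosh (of_real pi * z)) holomorphic_on A" for A
    unfolding cosh_field_def by (intro holomorphic_intros) auto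
  have holo: "f holomorphic_on S - {\<i> / 2}"
    unfolding f_def using nz by (intro holomorphic_intros cosh_holo) auto
  have im: "path_image R \<subseteq> S - {\<i> / 2}"
    using r unfolding R_def by (subst path_image_rectpath) (auto simp: S_def complex_eq_iff)
  have res: "residue f (\<i> / 2) = exp (\<i> * of_real pi * w / 2) / (of_real pi * \<i>)"
  proof -
    \<comment> \<open>The derivative is pi sinh (pi i / 2) = pi i, which becomes the denominator of
      the residue at the simple pole.\<close>
    have d: "((\<lambda>z. cosh (of_real pi * z)) has_field_derivative of_real pi * \<i>) (at (\<i> / 2))"
    proof -
      have "exp (of_real pi * (\<i> / 2)) = \<i>" "exp (- (of_real pi * (\<i> / 2))) = - \<i>"
        using cis_conv_exp[of "pi / 2"] cis_conv_exp[of "- (pi / 2)"] by (simp_all add: mult_ac cis_mult complex_eq_iff)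
      then show ?thesis
        unfolding cosh_field_def by (auto intro!: derivative_eq_intros simp: field_simps)
    qed
    have "residue (\<lambda>z. exp (of_real pi * w * z) / cosh (of_real pi * z)) (\<i> / 2)
        = exp (of_real pi * w * (\<i> / 2)) / (of_real pi * \<i>)"
    proof (rule residue_simple_pole_deriv[where s = S])
      have "cosh (of_real pi * (\<i> / 2)) = 0"
        using cis_conv_exp[of "pi / 2"] cis_conv_exp[of "- (pi / 2)"]
        by (simp add: cosh_field_def mult_ac complex_eq_iff)
      then show "cosh (of_real pi * (\<i> / 2)) = 0" .
    qed (use S d in \<open>auto intro!: holomorphic_intros cosh_holo simp: S_def\<close>)
    then show ?thesis
      by (simp add: f_def mult_ac)
  qed
  have "contour_integral R f = of_real (2 * pi) * \<i> * (\<Sum>p\<in>{\<i> / 2}. winding_number R p * residue f p)"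
  proof (rule Residue_theorem[OF S])
    have "cbox (- of_real r) (of_real r + \<i>) \<subseteq> S"
      by (auto simp: S_def in_cbox_complex_iff)
    then show "\<forall>z. z \<notin> S \<longrightarrow> winding_number R z = 0"
      unfolding R_def using r by (auto intro!: winding_number_rectpath_outside)
  qed (use holo im in \<open>auto simp: R_def\<close>)
  also have "\<dots> = of_real (2 * pi) * \<i> * (winding_number R (\<i> / 2) * residue f (\<i> / 2))"
    by (simp only: sum.insert[OF finite.emptyI empty_iff[THEN iffD1, THEN notI]] sum.empty add_0_right)
  also have "winding_number R (\<i> / 2) = 1"
    unfolding R_def using r by (intro winding_number_rectpath) (auto simp: in_box_complex_iff)
  also have "of_real (2 * pi) * \<i> * (1 * residue f (\<i> / 2)) = 2 * exp (\<i> * of_real pi * w / 2)"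
  proof -
    have "of_real (2 * pi) * \<i> * (1 * (E / (of_real pi * \<i>))) = 2 * E" for E :: complex
      by simp
    then show ?thesis
      unfolding res .
  qed
  finally have total: "contour_integral R f = 2 * exp (\<i> * of_real pi * w / 2)"
    .
  define p1 p2 p3 p4 :: complex
    where "p1 = - of_real r" and "p2 = of_real r" and "p3 = of_real r + \<i>" and "p4 = - of_real r + \<i>"
  have R: "R = linepath p1 p2 +++ linepath p2 p3 +++ linepath p3 p4 +++ linepath p4 p1"
    by (simp add: R_def rectpath_def Let_def p1_def p2_def p3_def p4_def Complex_eq)
  have cont: "continuous_on (path_image R) f"
    using holo im by (meson holomorphic_on_imp_continuous_on continuous_on_subset)
  have integ: "f contour_integrable_on linepath p1 p2" "f contour_integrable_on linepath p2 p3"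
      "f contour_integrable_on linepath p3 p4" "f contour_integrable_on linepath p4 p1"
    using cont unfolding R
    by (auto intro!: contour_integrable_continuous_linepath elim!: continuous_on_subset simp: path_image_join)
  have total': "contour_integral R f = contour_integral (linepath p1 p2) f + (contour_integral (linepath p2 p3) f
     + (contour_integral (linepath p3 p4) f + contour_integral (linepath p4 p1) f))"
    using integ unfolding R by simp
  have h1: "contour_integral (linepath p1 p2) f = I"
    unfolding I_def using r by (subst contour_integral_linepath_Reals_eq) (auto simp: p1_def p2_def)
  have shift: "f (z + \<i>) = - exp (\<i> * of_real pi * w) * f z" for z
  proof -
    have "exp (of_real pi * (z + \<i>)) = - exp (of_real pi * z)"
      "exp (- (of_real pi * (z + \<i>))) = - exp (- (of_real pi * z))"
      by (simp_all add: distrib_left exp_add exp_diff exp_pi_i exp_pi_i' exp_minus)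
    then have "cosh (of_real pi * (z + \<i>)) = - cosh (of_real pi * z)"
      by (simp add: cosh_field_def field_simps)
    moreover have "exp (of_real pi * w * (z + \<i>)) = exp (\<i> * of_real pi * w) * exp (of_real pi * w * z)"
      by (simp add: distrib_left exp_add mult_ac)
    ultimately show ?thesis
      by (simp add: f_def)
  qed
  \<comment> \<open>The segment from \<open>p4\<close> to \<open>p3\<close> is the bottom segment
    translated by i, so \<open>shift\<close> compares the integrands pointwise. Traversing the top
    from right to left changes the sign again and cancels the minus sign in
    \<open>shift\<close>.\<close>
  have h3: "contour_integral (linepath p3 p4) f = exp (\<i> * of_real pi * w) * I"
  proof -
    have "((\<lambda>x. f (linepath p1 p2 x) * (p2 - p1)) has_integral I) {0..1}"
      using has_contour_integral_integral[OF integ(1)] unfolding h1 has_contour_integral_linepath .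
    then have "((\<lambda>x. - exp (\<i> * of_real pi * w) * (f (linepath p1 p2 x) * (p2 - p1)))
        has_integral - exp (\<i> * of_real pi * w) * I) {0..1}"
      by (rule has_integral_mult_right)
    moreover have "- exp (\<i> * of_real pi * w) * (f (linepath p1 p2 x) * (p2 - p1)) = f (linepath p4 p3 x) * (p3 - p4)" for x
    proof -
      have "linepath p4 p3 x = linepath p1 p2 x + \<i>"
        by (simp add: linepath_def p1_def p2_def p3_def p4_def scaleR_conv_of_real algebra_simps)
      moreover have "p3 - p4 = p2 - p1"
        by (simp add: p1_def p2_def p3_def p4_def)
      ultimately show ?thesis
        by (simp only: shift mult.assoc)
    qed
    ultimately have "(f has_contour_integral - exp (\<i> * of_real pi * w) * I) (linepath p4 p3)"
      unfolding has_contour_integral_linepath by simp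
    then have "(f has_contour_integral - (- exp (\<i> * of_real pi * w) * I)) (linepath p3 p4)"
      using has_contour_integral_reversepath[of "linepath p4 p3" f] by (simp only: reversepath_linepath valid_path_linepath)
    then show ?thesis
      by (simp only: contour_integral_unique minus_mult_left minus_minus)
  qed
  have B0: "B \<ge> 0"
    using r by (simp add: B_def)
  have bound: "norm (f z) \<le> B" if "\<bar>Re z\<bar> = r" "0 \<le> Im z" "Im z \<le> 1" for z
  proof -
    have "Re w * Re z \<le> \<bar>Re w\<bar> * r" "- (Im w * Im z) \<le> \<bar>Im w\<bar>"
      using that abs_ge_self[of "Re w * Re z"] abs_ge_self[of "- (Im w * Im z)"] mult_left_le[of "Im z" "\<bar>Im w\<bar>"]
      by (auto simp: abs_mult)
    then have "pi * (Re w * Re z - Im w * Im z) \<le> pi * (\<bar>Re w\<bar> * r + \<bar>Im w\<bar>)"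
      by (intro mult_left_mono) auto
    moreover have "Re (of_real pi * w * z) = pi * (Re w * Re z - Im w * Im z)"
      by (simp add: algebra_simps)
    ultimately have "Re (of_real pi * w * z) \<le> pi * (\<bar>Re w\<bar> * r + \<bar>Im w\<bar>)"
      by linarith
    \<comment> \<open>On the vertical sides the denominator has size at least sinh (pi r), whatever
      the imaginary part; this growth is what beats the numerator when |Re w| < 1.\<close>
    moreover have "norm (cosh (of_real pi * z)) \<ge> sinh (pi * r)"
    proof -
      have "Re z = r \<or> Re z = - r"
        using that by auto
      then show ?thesis
        using norm_cosh_ge[of "of_real pi * z"] by auto
    qed
    ultimately show ?thesis
      unfolding f_def B_def norm_divide norm_exp_eq_Re using r by (intro frac_le) auto
  qed
  have v2: "norm (contour_integral (linepath p2 p3) f) \<le> B"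
  proof -
    have "norm (contour_integral (linepath p2 p3) f) \<le> B * norm (p3 - p2)"
      by (rule contour_integral_bound_linepath[OF integ(2) B0], rule bound)
        (use r in \<open>auto simp: p2_def p3_def closed_segment_same_Re closed_segment_eq_real_ivl\<close>)
    then show ?thesis
      by (simp add: p2_def p3_def)
  qed
  have v4: "norm (contour_integral (linepath p4 p1) f) \<le> B"
  proof -
    have "norm (contour_integral (linepath p4 p1) f) \<le> B * norm (p1 - p4)"
      by (rule contour_integral_bound_linepath[OF integ(4) B0], rule bound)
        (use r in \<open>auto simp: p1_def p4_def closed_segment_same_Re closed_segment_eq_real_ivl\<close>)
    then show ?thesis
      by (simp add: p1_def p4_def)
  qed
  have "(1 + exp (\<i> * of_real pi * w)) * I - 2 * exp (\<i> * of_real pi * w / 2)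
      = - (contour_integral (linepath p2 p3) f + contour_integral (linepath p4 p1) f)"
    using total total' h1 h3 by (simp add: algebra_simps)
  also have "norm \<dots> \<le> B + B"
    unfolding norm_minus_cancel by (rule norm_triangle_mono[OF v2 v4])
  finally show ?thesis
    by (simp add: I_def B_def)
qed

text \<open>A zero would force \<open>w\<close> to be an odd integer. The lemma allows division by
  this factor once the contour identity has passed to the limit.\<close>

lemma one_plus_exp_ne_0:
  assumes "\<bar>Re w\<bar> < 1"
  shows "1 + exp (\<i> * of_real pi * w) \<noteq> 0" 
proof
  assume "1 + exp (\<i> * of_real pi * w) = 0"
  then have "exp (\<i> * of_real pi * w) = exp (\<i> * of_real pi)"
    by (simp add: exp_pi_i' eq_neg_iff_add_eq_0 add.commute)
  then obtain n :: int where "\<i> * of_real pi * w = \<i> * of_real pi + of_int (2 * n) * of_real pi * \<i>"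
    unfolding exp_eq by auto
  then have "(\<i> * of_real pi) * w = (\<i> * of_real pi) * (1 + of_int (2 * n))"
    by (simp add: field_simps)
  then have "w = 1 + of_int (2 * n)"
    by (subst (asm) mult_cancel_left) auto
  then have "Re w = of_int (1 + 2 * n)"
    by simp
  with assms have "\<bar>1 + 2 * n\<bar> < 1"
    by linarith
  then show False by presburger
qed

text \<open>Letting r tend to infinity in the rectangle estimate leaves (1 + exp (i pi w)) I = 2 exp
  (i pi w / 2), and 1 + exp (i pi w) = 2 exp (i pi w / 2) cos (pi w / 2). Complex \<open>w\<close>
  matters: its imaginary part will carry the Fourier frequency.\<close>

lemma integral_exp_div_cosh:
  assumes w: "\<bar>Re w\<bar> < 1"
  shows "(LBINT x. exp (of_real pi * w * of_real x) / cosh (of_real (pi * x) :: complex)) = 1 / cos (of_real pi * w / 2)"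
    (is "integral\<^sup>L lborel ?f = _")
proof -
  have int: "integrable lborel ?f"
    by (rule integrable_cexp_div_cosh[OF w])
  \<comment> \<open>Dominated convergence recovers the whole-line integral from the symmetric
    truncations to which the contour estimate applies.\<close>
  have "((\<lambda>r. LBINT x. indicator {-r..r} x *\<^sub>R ?f x) \<longlongrightarrow> integral\<^sup>L lborel ?f) at_top"
  proof (rule integral_dominated_convergence_at_top[where w = "\<lambda>x. norm (?f x)"])
    show "AE x in lborel. ((\<lambda>r. indicator {-r..r} x *\<^sub>R ?f x) \<longlongrightarrow> ?f x) at_top"
    proof (intro AE_I2 tendsto_eventually)
      fix x :: real
      show "\<forall>\<^sub>F r in at_top. indicator {-r..r} x *\<^sub>R ?f x = ?f x"
        using eventually_ge_at_top[of "\<bar>x\<bar>"] by eventually_elim (auto simp: indicator_def)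
    qed
    show "\<forall>\<^sub>F r in at_top. AE x in lborel. norm (indicator {-r..r} x *\<^sub>R ?f x) \<le> norm (?f x)"
      by (intro always_eventually allI AE_I2) (auto simp: indicator_def)
  qed (use int in \<open>auto intro: borel_measurable_integrable\<close>)
  also have "(\<lambda>r. LBINT x. indicator {-r..r} x *\<^sub>R ?f x) = (\<lambda>r. integral {-r..r} ?f)"
  proof
    fix r :: real
    have "set_integrable lborel {-r..r} ?f"
      using int by (rule integrable_mult_indicator[of "{-r..r}" lborel ?f, folded set_integrable_def, rotated]) simp
    then show "(LBINT x. indicator {-r..r} x *\<^sub>R ?f x) = integral {-r..r} ?f"
      by (subst set_borel_integral_eq_integral(2)[symmetric]) (auto simp: set_lebesgue_integral_def)
  qed
  finally have lim: "((\<lambda>r. integral {-r..r} ?f) \<longlongrightarrow> integral\<^sup>L lborel ?f) at_top" .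
  let ?e = "exp (\<i> * of_real pi * w)"
  let ?B = "\<lambda>r. 2 * (exp (pi * (\<bar>Re w\<bar> * r + \<bar>Im w\<bar>)) / sinh (pi * r))"
  have "(?B \<longlongrightarrow> 0) at_top"
  proof -
    \<comment> \<open>Pulling exp (pi r) out of both numerator and sinh leaves the decay rate
      \<open>k\<close>, positive exactly because |Re w| < 1, and a constant exp c.\<close>
    define k c where "k = pi * (1 - \<bar>Re w\<bar>)" and "c = pi * \<bar>Im w\<bar>"
    have "k > 0"
      using w by (simp add: k_def)
    then have "((\<lambda>r. 4 * exp c * exp (- k * r) / (1 - exp (- 2 * pi * r))) \<longlongrightarrow> 0) at_top"
      by real_asymp
    also have "(\<lambda>r. 4 * exp c * exp (- k * r) / (1 - exp (- 2 * pi * r))) = ?B"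
    proof
      fix r
      have 1: "sinh (pi * r) = exp (pi * r) * (1 - exp (- 2 * pi * r)) / 2"
        by (simp add: sinh_field_def right_diff_distrib flip: exp_add)
      have 2: "exp (pi * (\<bar>Re w\<bar> * r + \<bar>Im w\<bar>)) = exp (pi * r) * (exp c * exp (- k * r))"
        by (simp add: k_def c_def algebra_simps flip: exp_add)
      show "4 * exp c * exp (- k * r) / (1 - exp (- 2 * pi * r)) = ?B r"
        unfolding 1 2 by simp
    qed
    finally show ?thesis .
  qed
  then have "((\<lambda>r. (1 + ?e) * integral {-r..r} ?f - 2 * exp (\<i> * of_real pi * w / 2)) \<longlongrightarrow> 0) at_top"
  proof (rule Lim_null_comparison[rotated])
    show "\<forall>\<^sub>F r in at_top. norm ((1 + ?e) * integral {-r..r} ?f - 2 * exp (\<i> * of_real pi * w / 2)) \<le> ?B r"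
      using eventually_gt_at_top[of 0]
      by eventually_elim (use rectangle_integral_exp_div_cosh[of _ w] in auto)
  qed
  moreover have "((\<lambda>r. (1 + ?e) * integral {-r..r} ?f - 2 * exp (\<i> * of_real pi * w / 2)) \<longlongrightarrow>
      (1 + ?e) * integral\<^sup>L lborel ?f - 2 * exp (\<i> * of_real pi * w / 2)) at_top"
    by (intro tendsto_intros lim)
  ultimately have eq: "(1 + ?e) * integral\<^sup>L lborel ?f - 2 * exp (\<i> * of_real pi * w / 2) = 0"
    using tendsto_unique by force
  have e: "1 + ?e = cos (of_real pi * w / 2) * (2 * exp (\<i> * of_real pi * w / 2))"
    by (simp add: cos_exp_eq distrib_left distrib_right mult_exp_exp field_simps)
  have solve: "I = 1 / C" if "P * I - 2 * E = 0" "P = C * (2 * E)" "P \<noteq> 0" for I C E P :: complex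
    using that by (auto simp: field_simps)
  show ?thesis
    by (rule solve[OF eq e one_plus_exp_ne_0[OF w]])
qed

section \<open>The Gaussian Fourier transform and Parseval's identity\<close>

lemma gaussian_fourier:
  fixes a x :: real
  assumes "a > 0"
  shows "(LBINT t. exp (2 * of_real pi * \<i> * of_real t * of_real x) * of_real (exp (- pi * t\<^sup>2 / a)))
           = of_real (sqrt a * exp (- pi * a * x\<^sup>2))"
proof -
  \<comment> \<open>The transform is the characteristic function of the standard normal law after
    the substitution u = c t: this \<open>c\<close> turns exp (-u^2 / 2) into exp (-pi t^2 / a), and
    \<open>s\<close> below is chosen so that s c = 2 pi x.\<close>
  define c where "c = sqrt (2 * pi / a)"
  have c: "c > 0" "c\<^sup>2 = 2 * pi / a"
    using assms by (auto simp: c_def)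
  define s where "s = 2 * pi * x / c"
  have "of_real (exp (- (s\<^sup>2) / 2)) = (CLINT u|std_normal_distribution. iexp (s * u))"
    using fun_cong[OF char_std_normal_distribution, of s] by (simp add: char_def)
  also have "\<dots> = (LBINT u. std_normal_density u *\<^sub>R iexp (s * u))"
    by (rule integral_density) auto
  also have "\<dots> = c *\<^sub>R (LBINT t. std_normal_density (0 + c * t) *\<^sub>R iexp (s * (0 + c * t)))"
    using lborel_integral_real_affine[of c "\<lambda>u. std_normal_density u *\<^sub>R iexp (s * u)" 0] c by simp
  also have "(\<lambda>t. std_normal_density (0 + c * t) *\<^sub>R iexp (s * (0 + c * t)))
     = (\<lambda>t. of_real (1 / sqrt (2 * pi)) * (exp (2 * of_real pi * \<i> * of_real t * of_real x) * of_real (exp (- pi * t\<^sup>2 / a))))"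
  proof
    fix t
    have "(c * t)\<^sup>2 / 2 = pi * t\<^sup>2 / a"
      using c assms by (simp add: power_mult_distrib field_simps)
    then have "std_normal_density (0 + c * t) = 1 / sqrt (2 * pi) * exp (- pi * t\<^sup>2 / a)"
      by (simp add: std_normal_density_def)
    moreover have "iexp (s * (0 + c * t)) = exp (2 * of_real pi * \<i> * of_real t * of_real x)"
      using c by (simp add: s_def mult_ac)
    ultimately show "std_normal_density (0 + c * t) *\<^sub>R iexp (s * (0 + c * t))
      = of_real (1 / sqrt (2 * pi)) * (exp (2 * of_real pi * \<i> * of_real t * of_real x) * of_real (exp (- pi * t\<^sup>2 / a)))"
      by (simp add: scaleR_conv_of_real mult_ac)
  qed
  also have "c *\<^sub>R (LBINT t. of_real (1 / sqrt (2 * pi)) * (exp (2 * of_real pi * \<i> * of_real t * of_real x) * of_real (exp (- pi * t\<^sup>2 / a))))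
    = of_real (c / sqrt (2 * pi)) * (LBINT t. exp (2 * of_real pi * \<i> * of_real t * of_real x) * of_real (exp (- pi * t\<^sup>2 / a)))"
    by (simp add: scaleR_conv_of_real)
  also have "c / sqrt (2 * pi) = 1 / sqrt a"
    by (simp add: c_def real_sqrt_divide)
  also have "- (s\<^sup>2) / 2 = - pi * a * x\<^sup>2"
    using c assms by (simp add: s_def power_mult_distrib power_divide field_simps power2_eq_square)
  finally show ?thesis
    using assms by (simp add: field_simps)
qed

lemma integrable_gaussian:
  fixes a :: real
  assumes "a > 0"
  shows "integrable lborel (\<lambda>t. exp (- pi * t\<^sup>2 / a))"
proof -
  have eq: "(\<lambda>t. exp (- pi * t\<^sup>2 / a)) = (\<lambda>t. sqrt a * normal_density 0 (sqrt (a / (2 * pi))) t)"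
    using assms by (auto simp: normal_density_def field_simps)
  show ?thesis
    unfolding eq using assms by (intro integrable_mult_right integrable_normal_density) auto
qed

lemma integrable_mult_gaussian:
  fixes f :: "real \<Rightarrow> 'a :: {banach, second_countable_topology, real_normed_algebra_1}"
  assumes "integrable lborel f" "a > 0"
  shows "integrable lborel (\<lambda>x. f x * of_real (exp (- pi * a * x\<^sup>2)))"
proof (rule Bochner_Integration.integrable_bound[OF assms(1)])
  have [measurable]: "f \<in> borel_measurable lborel"
    using assms(1) by (rule borel_measurable_integrable)
  show "(\<lambda>x. f x * of_real (exp (- pi * a * x\<^sup>2))) \<in> borel_measurable lborel"
    by measurable
  have "norm (f x * of_real (exp (- pi * a * x\<^sup>2))) \<le> norm (f x) * 1" for x
    using norm_mult_ineq[of "f x" "of_real (exp (- pi * a * x\<^sup>2))"] assms(2)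
    by (elim order_trans) (auto intro!: mult_left_le)
  then show "AE x in lborel. norm (f x * of_real (exp (- pi * a * x\<^sup>2))) \<le> norm (f x)"
    by simp
qed

text \<open>Write the Gaussian in \<open>x\<close> as the integral from
  \<open>gaussian_fourier\<close> and exchange the two integrations. Fubini applies because the
  modulus of the kernel is the product of |g x| and a Gaussian in \<open>t\<close>, both
  integrable.\<close>

lemma gaussian_parseval:
  fixes g :: "real \<Rightarrow> complex"
  assumes g: "integrable lborel g" and a: "a > 0"
  shows "of_real (sqrt a) * (LBINT x. g x * of_real (exp (- pi * a * x\<^sup>2)))
    = (LBINT t. (LBINT x. g x * exp (2 * of_real pi * \<i> * of_real t * of_real x)) * of_real (exp (- pi * t\<^sup>2 / a)))"
proof -
  have [measurable]: "g \<in> borel_measurable lborel"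
    using g by (rule borel_measurable_integrable)
  let ?K = "\<lambda>x t. g x * (exp (2 * of_real pi * \<i> * of_real t * of_real x) * of_real (exp (- pi * t\<^sup>2 / a)))"
  have K: "norm (?K x t) = norm (g x) * exp (- pi * t\<^sup>2 / a)" for x t
    by (simp add: norm_mult)
  have "integrable (lborel \<Otimes>\<^sub>M lborel) (\<lambda>(x, t). ?K x t)"
  proof (rule lborel_pair.Fubini_integrable)
    show "(\<lambda>(x, t). ?K x t) \<in> borel_measurable (lborel \<Otimes>\<^sub>M lborel)"
      by measurable
    show "integrable lborel (\<lambda>x. LBINT t. norm (case (x, t) of (x, t) \<Rightarrow> ?K x t))"
      unfolding prod.case K integral_mult_right_zero by (intro integrable_mult_left integrable_norm g)
    show "AE x in lborel. integrable lborel (\<lambda>t. case (x, t) of (x, t) \<Rightarrow> ?K x t)"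
    proof (intro AE_I2)
      fix x :: real
      have "integrable lborel (\<lambda>t. norm (g x) * exp (- pi * t\<^sup>2 / a))"
        using integrable_gaussian[OF a] by simp
      then show "integrable lborel (\<lambda>t. case (x, t) of (x, t) \<Rightarrow> ?K x t)"
        by (rule Bochner_Integration.integrable_bound) (auto simp: norm_mult)
    qed
  qed
  then have "(LBINT t. LBINT x. ?K x t) = (LBINT x. LBINT t. ?K x t)"
    by (rule lborel_pair.Fubini_integral)
  also have "\<dots> = (LBINT x. of_real (sqrt a) * (g x * of_real (exp (- pi * a * x\<^sup>2))))"
    by (intro Bochner_Integration.integral_cong refl, subst integral_mult_right_zero)
      (use gaussian_fourier[OF a] in \<open>simp add: mult_ac\<close>)
  also have "\<dots> = of_real (sqrt a) * (LBINT x. g x * of_real (exp (- pi * a * x\<^sup>2)))"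
    by (rule integral_mult_right_zero)
  also have "(LBINT t. LBINT x. ?K x t) = (LBINT t. (LBINT x. g x * exp (2 * of_real pi * \<i> * of_real t * of_real x)) * of_real (exp (- pi * t\<^sup>2 / a)))"
    by (simp flip: mult.assoc)
  finally show ?thesis by simp
qed

section \<open>The quotient cosh (pi s x) / cosh (pi x) and its Fourier transform\<close>

lemma integrable_cosh_div_cosh:
  fixes s :: real
  assumes s: "\<bar>s\<bar> < 1"
  shows "integrable lborel (\<lambda>x. cosh (pi * s * x) / cosh (pi * x))"
proof -
  have "integrable lborel (\<lambda>x. (exp (pi * s * x) / cosh (pi * x) + exp (pi * (-s) * x) / cosh (pi * x)) / 2)"
    using s by (intro Bochner_Integration.integrable_add integrable_divide_zero integrable_exp_div_cosh) auto
  also have "(\<lambda>x. (exp (pi * s * x) / cosh (pi * x) + exp (pi * (-s) * x) / cosh (pi * x)) / 2)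
     = (\<lambda>x. (exp (pi * s * x) + exp (- (pi * s * x))) / 2 / cosh (pi * x))"
    by (simp add: add_divide_distrib mult.commute)
  also have "\<dots> = (\<lambda>x. cosh (pi * s * x) / cosh (pi * x))"
    by (simp only: cosh_field_def[of "_ * _ * _"])
  finally show ?thesis .
qed

lemma integrable_cosh_div_cosh_gaussian:
  fixes s a :: real
  assumes "\<bar>s\<bar> < 1" "a > 0"
  shows "integrable lborel (\<lambda>x. cosh (pi * s * x) / cosh (pi * x) * exp (- pi * a * x\<^sup>2))"
  using integrable_mult_gaussian[OF integrable_cosh_div_cosh[OF assms(1)] assms(2)] by simp

text \<open>Cosine at an imaginary argument is cosh and the integrand is even, so the complex
  half-line integral is half of a real integral over the whole line, where Fourier analysis
  applies.\<close>

lemma mordell_phi_imaginary: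
  fixes s a :: real
  assumes "\<bar>s\<bar> < 1" "a > 0"
  shows "mordell_phi a (\<i> * of_real s)
    = of_real ((LBINT x. cosh (pi * s * x) / cosh (pi * x) * exp (- pi * a * x\<^sup>2)) / 2)"
proof -
  let ?f = "\<lambda>x. cosh (pi * s * x) / cosh (pi * x) * exp (- pi * a * x\<^sup>2)"
  have int: "integrable lborel ?f"
    using assms by (rule integrable_cosh_div_cosh_gaussian)
  define J where "J = (LBINT x. indicator {0..} x *\<^sub>R ?f x)"
  have "integrable lborel (\<lambda>x. indicator {0..} x *\<^sub>R ?f x)"
    using int by (rule integrable_mult_indicator[rotated]) simp
  then have "has_bochner_integral lborel (\<lambda>x. indicator {0..} x *\<^sub>R ?f x) J"
    unfolding J_def by (rule has_bochner_integral_integrable)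
  from has_bochner_integral_even_function[OF this] have J: "integral\<^sup>L lborel ?f = 2 * J"
    by (simp add: has_bochner_integral_iff)
  have cos: "cos (of_real pi * (\<i> * of_real s) * of_real x) = (of_real (cosh (pi * s * x)) :: complex)" for x
    by (simp add: cos_exp_eq cosh_field_def mult_ac exp_of_real[symmetric] flip: exp_minus)
  have "mordell_phi a (\<i> * of_real s) = (LBINT x. of_real (indicator {0..} x *\<^sub>R ?f x))"
    unfolding mordell_phi_def set_lebesgue_integral_def cos
    by (intro Bochner_Integration.integral_cong) (auto simp: scaleR_conv_of_real)
  also have "\<dots> = of_real J"
    unfolding J_def by (rule integral_complex_of_real)
  finally show ?thesis
    unfolding J by simp
qed

text \<open>Splitting cosh (pi s x) into exponentials gives the mean of two integrals of the form in
  \<open>integral_exp_div_cosh\<close>, with w = s + 2it and w = -s + 2it. The resulting cosines are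
  the conjugates p - iq and p + iq, so the mean of their reciprocals is p / (p^2 + q^2).\<close>

lemma fourier_cosh_div_cosh:
  fixes s t :: real
  assumes s: "\<bar>s\<bar> < 1"
  shows "(LBINT x. of_real (cosh (pi * s * x) / cosh (pi * x)) * exp (2 * of_real pi * \<i> * of_real t * of_real x))
    = (of_real (2 * cos (pi * s / 2) * cosh (pi * t) / (cos (pi * s) + cosh (2 * pi * t))) :: complex)"
proof -
  let ?F = "\<lambda>w x. exp (of_real pi * w * of_real x) / cosh (of_real (pi * x) :: complex)"
  define w1 w2 where "w1 = of_real s + 2 * \<i> * of_real t" and "w2 = - of_real s + 2 * \<i> * of_real t"
  have w: "\<bar>Re w1\<bar> < 1" "\<bar>Re w2\<bar> < 1"
    using s by (auto simp: w1_def w2_def)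
  define p q where "p = cos (pi * s / 2) * cosh (pi * t)" and "q = sin (pi * s / 2) * sinh (pi * t)"
  have "(LBINT x. of_real (cosh (pi * s * x) / cosh (pi * x)) * exp (2 * of_real pi * \<i> * of_real t * of_real x))
    = (LBINT x. (?F w1 x + ?F w2 x) / 2)"
  proof (intro Bochner_Integration.integral_cong refl)
    fix x :: real
    have c: "of_real (cosh (pi * x)) = (cosh (of_real (pi * x)) :: complex)"
      by (simp add: cosh_field_def flip: exp_of_real)
    have "(of_real (cosh (pi * s * x)) :: complex) * exp (2 * of_real pi * \<i> * of_real t * of_real x)
      = (exp (of_real pi * w1 * of_real x) + exp (of_real pi * w2 * of_real x)) / 2"
    proof -
      have "(of_real (cosh (pi * s * x)) :: complex)
          = (exp (of_real (pi * s * x)) + exp (- of_real (pi * s * x))) / 2"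
        by (simp only: cosh_field_def of_real_divide of_real_add of_real_minus of_real_numeral flip: exp_of_real)
      then show ?thesis
        by (simp add: w1_def w2_def distrib_right mult_exp_exp add_divide_distrib) (simp add: algebra_simps)
    qed
    then show "of_real (cosh (pi * s * x) / cosh (pi * x)) * exp (2 * of_real pi * \<i> * of_real t * of_real x)
        = (?F w1 x + ?F w2 x) / 2"
      unfolding of_real_divide c by (simp add: add_divide_distrib mult.commute)
  qed
  also have "\<dots> = (1 / cos (of_real pi * w1 / 2) + 1 / cos (of_real pi * w2 / 2)) / 2"
    using integrable_cexp_div_cosh[OF w(1)] integrable_cexp_div_cosh[OF w(2)]
    by (simp only: integral_divide_zero Bochner_Integration.integral_add integral_exp_div_cosh[OF w(1)] integral_exp_div_cosh[OF w(2)])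
  also have "cos (of_real pi * w1 / 2) = Complex p (- q)"
  proof -
    have "of_real pi * w1 / 2 = Complex (pi * s / 2) (pi * t)"
      by (simp add: w1_def complex_eq_iff)
    then show ?thesis
      by (simp add: complex_eq_iff Re_cos Im_cos p_def q_def cosh_field_def sinh_field_def field_simps)
  qed
  also have "cos (of_real pi * w2 / 2) = Complex p q"
  proof -
    have "of_real pi * w2 / 2 = Complex (- (pi * s / 2)) (pi * t)"
      by (simp add: w2_def complex_eq_iff)
    then show ?thesis
      by (simp add: complex_eq_iff Re_cos Im_cos p_def q_def cosh_field_def sinh_field_def field_simps)
  qed
  also have "(1 / Complex p (- q) + 1 / Complex p q) / 2 = of_real (p / (p\<^sup>2 + q\<^sup>2))"
  proof -
    have inv: "1 / Complex p r = Complex p (- r) / of_real (p\<^sup>2 + r\<^sup>2)" for r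
      by (subst complex_div_cnj) (simp add: cmod_power2 complex_cnj)
    have "1 / Complex p (- q) + 1 / Complex p q = (Complex p q + Complex p (- q)) / of_real (p\<^sup>2 + q\<^sup>2)"
      unfolding inv by (simp add: add_divide_distrib)
    also have "Complex p q + Complex p (- q) = of_real (2 * p)"
      by (simp add: complex_eq_iff)
    finally have e: "1 / Complex p (- q) + 1 / Complex p q = of_real (2 * p) / of_real (p\<^sup>2 + q\<^sup>2)" .
    have half: "of_real (2 * p) / N / 2 = of_real p / N" for N :: complex
      by simp
    show ?thesis
      unfolding e half of_real_divide ..
  qed
  also have "p / (p\<^sup>2 + q\<^sup>2) = 2 * cos (pi * s / 2) * cosh (pi * t) / (cos (pi * s) + cosh (2 * pi * t))"
  proof -
    have 1: "cos (pi * s) = 2 * (cos (pi * s / 2))\<^sup>2 - 1"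
      using cos_double_cos[of "pi * s / 2"] by simp
    have 2: "cosh (2 * pi * t) = 2 * (cosh (pi * t))\<^sup>2 - 1"
      using cosh_double_cosh[of "pi * t"] by (simp add: mult.assoc)
    \<comment> \<open>After expansion the product of cos^2 and cosh^2 cancels, leaving cos^2 +
      cosh^2 - 1, half the sum of the two double-angle expressions.\<close>
    have "p\<^sup>2 + q\<^sup>2 = (cos (pi * s / 2))\<^sup>2 * (cosh (pi * t))\<^sup>2 + (1 - (cos (pi * s / 2))\<^sup>2) * ((cosh (pi * t))\<^sup>2 - 1)"
      by (simp add: p_def q_def power_mult_distrib sin_squared_eq sinh_square_eq)
    then have pq: "p\<^sup>2 + q\<^sup>2 = (cos (pi * s) + cosh (2 * pi * t)) / 2"
      unfolding 1 2 by (simp add: algebra_simps)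
    show ?thesis
      unfolding pq by (simp add: p_def)
  qed
  finally show ?thesis .
qed

text \<open>Parseval followed by the substitution t = x / 6. As a b = 1/36, the dual Gaussian exp
  (-pi t^2 / a) becomes exp (-pi b x^2), and the Jacobian is the factor 1/6.\<close>

lemma gaussian_cosh_div_cosh_transform:
  fixes s a b :: real
  assumes s: "\<bar>s\<bar> < 1" and a: "a > 0" and b: "a * b = 1 / 36"
  shows "sqrt a * (LBINT x. cosh (pi * s * x) / cosh (pi * x) * exp (- pi * a * x\<^sup>2))
    = (LBINT x. 2 * cos (pi * s / 2) * cosh (pi * x / 6) / (cos (pi * s) + cosh (pi * x / 3)) * exp (- pi * b * x\<^sup>2)) / 6"
proof -
  let ?h = "\<lambda>t. 2 * cos (pi * s / 2) * cosh (pi * t) / (cos (pi * s) + cosh (2 * pi * t)) * exp (- pi * t\<^sup>2 / a)"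
  have "integrable lborel (\<lambda>x. of_real (cosh (pi * s * x) / cosh (pi * x)) :: complex)"
    using integrable_cosh_div_cosh[OF s] by (simp only: complex_of_real_integrable_eq)
  from gaussian_parseval[OF this a]
  have "of_real (sqrt a) * (LBINT x. of_real (cosh (pi * s * x) / cosh (pi * x) * exp (- pi * a * x\<^sup>2))) = (LBINT t. (of_real (?h t) :: complex))"
    unfolding fourier_cosh_div_cosh[OF s] by (simp only: of_real_mult)
  then have "sqrt a * (LBINT x. cosh (pi * s * x) / cosh (pi * x) * exp (- pi * a * x\<^sup>2)) = (LBINT t. ?h t)"
    unfolding integral_complex_of_real by (simp only: flip: of_real_mult) (simp only: of_real_eq_iff)
  also have "\<dots> = (1 / 6) * (LBINT x. ?h (0 + 1 / 6 * x))"
    using lborel_integral_real_affine[of "1 / 6" ?h 0] by simp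
  also have "(\<lambda>x. ?h (0 + 1 / 6 * x)) = (\<lambda>x. 2 * cos (pi * s / 2) * cosh (pi * x / 6) / (cos (pi * s) + cosh (pi * x / 3)) * exp (- pi * b * x\<^sup>2))"
  proof
    fix x :: real
    have "- pi * (0 + 1 / 6 * x)\<^sup>2 / a = - pi * b * x\<^sup>2"
      using a b by (simp add: field_simps power2_eq_square)
    moreover have "pi * (0 + 1 / 6 * x) = pi * x / 6" "2 * pi * (0 + 1 / 6 * x) = pi * x / 3"
      by simp_all
    ultimately show "?h (0 + 1 / 6 * x) = 2 * cos (pi * s / 2) * cosh (pi * x / 6) / (cos (pi * s) + cosh (pi * x / 3)) * exp (- pi * b * x\<^sup>2)"
      by (simp only:)
  qed
  finally show ?thesis by simp
qed

section \<open>Multiple-angle formulas and the decomposition of the transformed kernels\<close>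

lemma cosh_Suc_multiple: "cosh ((n + 1) * y) = 2 * cosh y * cosh (n * y) - cosh ((n - 1) * y)" for n y :: real
  by (simp add: distrib_right left_diff_distrib cosh_add cosh_diff)

text \<open>These are the Chebyshev polynomials T_2, T_3, T_5, T_6 at cosh y, from the three-term
  recurrence. With y = pi x / 6 they turn every kernel into a rational function of one
  variable.\<close>

lemma cosh_multiples:
  fixes y :: real
  defines "c \<equiv> cosh y"
  shows "cosh (2 * y) = 2 * c^2 - 1" "cosh (3 * y) = 4 * c^3 - 3 * c"
    "cosh (5 * y) = 16 * c^5 - 20 * c^3 + 5 * c" "cosh (6 * y) = 32 * c^6 - 48 * c^4 + 18 * c^2 - 1"
proof -
  show 2: "cosh (2 * y) = 2 * c^2 - 1"
    using cosh_Suc_multiple[of 1 y] by (simp add: c_def power2_eq_square)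
  show 3: "cosh (3 * y) = 4 * c^3 - 3 * c"
  proof -
    have "cosh (3 * y) = 2 * c * cosh (2 * y) - c"
      using cosh_Suc_multiple[of 2 y] by (simp add: c_def)
    then show ?thesis
      unfolding 2 by algebra
  qed
  have 4: "cosh (4 * y) = 8 * c^4 - 8 * c^2 + 1"
  proof -
    have "cosh (4 * y) = 2 * c * cosh (3 * y) - cosh (2 * y)"
      using cosh_Suc_multiple[of 3 y] by (simp add: c_def)
    then show ?thesis
      unfolding 2 3 by algebra
  qed
  show 5: "cosh (5 * y) = 16 * c^5 - 20 * c^3 + 5 * c"
  proof -
    have "cosh (5 * y) = 2 * c * cosh (4 * y) - cosh (3 * y)"
      using cosh_Suc_multiple[of 4 y] by (simp add: c_def)
    then show ?thesis
      unfolding 3 4 by algebra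
  qed
  show "cosh (6 * y) = 32 * c^6 - 48 * c^4 + 18 * c^2 - 1"
  proof -
    have "cosh (6 * y) = 2 * c * cosh (5 * y) - cosh (4 * y)"
      using cosh_Suc_multiple[of 5 y] by (simp add: c_def)
    then show ?thesis
      unfolding 4 5 by algebra
  qed
qed

text \<open>Put c = cosh (pi x / 6), C = cosh (pi x / 3) = 2 c^2 - 1 and h = sqrt 3 / 2. Then cosh
  (pi x) = 4 C (C + h) (C - h), and the three denominators on the left are precisely C, C + h and C
  - h. Over the common denominator cosh (pi x), each numerator is c times the other two factors, an
  odd polynomial of degree 5 in c, hence a combination of T_5, T_3 and T_1, the numerators of g
  (5/6), g (1/2) and g (1/6).\<close>

lemma transformed_kernels:
  fixes x :: real
  defines "g \<equiv> (\<lambda>s. cosh (pi * s * x) / cosh (pi * x))"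
  shows "cosh (pi * x / 6) / (cos (pi * (1/2)) + cosh (pi * x / 3))
      = 1 * g (5/6) + 1 * g (1/2) + (- 1) * g (1/6)" (is ?A)
    and "cosh (pi * x / 6) / (cos (pi * (1/6)) + cosh (pi * x / 3))
      = 1 * g (5/6) + (1 - sqrt 3) * g (1/2) + (2 - sqrt 3) * g (1/6)" (is ?B)
    and "cosh (pi * x / 6) / (cos (pi * (5/6)) + cosh (pi * x / 3))
      = 1 * g (5/6) + (1 + sqrt 3) * g (1/2) + (2 + sqrt 3) * g (1/6)" (is ?C)
proof -
  define y where "y = pi * x / 6"
  define c where "c = cosh y"
  define C where "C = 2 * c^2 - 1"
  define h :: real where "h = sqrt 3 / 2"
  have h2: "h^2 = 3/4" and h: "h > 0" "h < 1" and r: "sqrt 3 = 2 * h"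
    by (auto simp: h_def power_divide real_less_lsqrt)
  have "c \<ge> 1"
    by (simp add: c_def cosh_real_ge_1)
  then have "c^2 \<ge> 1"
    by simp
  then have C: "C \<ge> 1"
    by (simp add: C_def)
  have nz: "C \<noteq> 0" "h + C \<noteq> 0" "- h + C \<noteq> 0"
    using C h by auto
  have c1: "cosh (pi * x / 6) = c" and c2: "cosh (pi * x / 3) = C" and c3: "cosh (pi * (1/6) * x) = c"
    and c4: "cosh (pi * (1/2) * x) = 4 * c^3 - 3 * c" and c5: "cosh (pi * (5/6) * x) = 16 * c^5 - 20 * c^3 + 5 * c"
    using cosh_multiples[of y] by (simp_all add: c_def C_def y_def mult_ac)
  have c6: "cosh (pi * x) = 32 * c^6 - 48 * c^4 + 18 * c^2 - 1"
    using cosh_multiples(4)[of y] by (simp add: c_def y_def)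
  have "(h + C) * (- h + C) = C^2 - h^2"
    by algebra
  then have v: "4 * ((h + C) * (- h + C)) = 4 * C^2 - 3"
    unfolding h2 by simp
  have prod: "cosh (pi * x) = C * (4 * ((h + C) * (- h + C)))"
    unfolding c6 v unfolding C_def by algebra
  have angles: "cos (pi * (1/2)) = (0::real)" "cos (pi * (1/6)) = h" "cos (pi * (5/6)) = - h"
    using cos_pi_minus[of "pi / 6"] by (simp_all add: cos_30 h_def mult.commute)
  \<comment> \<open>Here \<open>w\<close> stands for cosh (pi x), \<open>u\<close> for the
    denominator on the left, and \<open>v\<close> for 4 times the product of the two remaining
    factors.\<close>
  have sum: "p1 * (q1 / w) + p2 * (q2 / w) + p3 * (q3 / w) = e / u"
    if "p1 * q1 + p2 * q2 + p3 * q3 = e * v" "w = u * v" "v \<noteq> 0" for p1 p2 p3 q1 q2 q3 e u v w :: real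
  proof -
    have "p1 * (q1 / w) + p2 * (q2 / w) + p3 * (q3 / w) = (p1 * q1 + p2 * q2 + p3 * q3) / w"
      by (simp add: add_divide_distrib)
    then show ?thesis
      unfolding that(1,2) using that(3) by simp
  qed
  note rules = g_def c1 c2 c3 c4 c5 angles r
  show ?A
    unfolding rules add_0_left
  proof (rule sum[symmetric])
    show "1 * (16 * c^5 - 20 * c^3 + 5 * c) + 1 * (4 * c^3 - 3 * c) + - 1 * c = c * (4 * ((h + C) * (- h + C)))"
      unfolding v unfolding C_def by algebra
  qed (use nz prod in auto)
  show ?B
    unfolding rules
  proof (rule sum[symmetric])
    show "1 * (16 * c^5 - 20 * c^3 + 5 * c) + (1 - 2 * h) * (4 * c^3 - 3 * c) + (2 - 2 * h) * c = c * (4 * (C * (- h + C)))"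
      unfolding C_def by algebra
  qed (use nz prod in auto)
  show ?C
    unfolding rules
  proof (rule sum[symmetric])
    show "1 * (16 * c^5 - 20 * c^3 + 5 * c) + (1 + 2 * h) * (4 * c^3 - 3 * c) + (2 + 2 * h) * c = c * (4 * (C * (h + C)))"
      unfolding C_def by algebra
  qed (use nz prod in auto)
qed

section \<open>The linear transformation of the integrals and the invariant quadratic form\<close>

definition mordell_int :: "real \<Rightarrow> real \<Rightarrow> real" where
  "mordell_int a s = (LBINT x. cosh (pi * s * x) / cosh (pi * x) * exp (- pi * a * x\<^sup>2))"

lemma mordell_int_lincomb:
  fixes p q r b :: real
  assumes "b > 0"
  shows "(LBINT x. (p * (cosh (pi * (5/6) * x) / cosh (pi * x)) + q * (cosh (pi * (1/2) * x) / cosh (pi * x))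
      + r * (cosh (pi * (1/6) * x) / cosh (pi * x))) * exp (- pi * b * x\<^sup>2))
    = p * mordell_int b (5/6) + q * mordell_int b (1/2) + r * mordell_int b (1/6)"
proof -
  define f where "f s x = cosh (pi * s * x) / cosh (pi * x) * exp (- pi * b * x\<^sup>2)" for s x
  have "integrable lborel (f s)" if "\<bar>s\<bar> < 1" for s
    using integrable_cosh_div_cosh_gaussian[OF that assms] unfolding f_def .
  then have "(LBINT x. p * f (5/6) x + q * f (1/2) x + r * f (1/6) x)
      = p * integral\<^sup>L lborel (f (5/6)) + q * integral\<^sup>L lborel (f (1/2)) + r * integral\<^sup>L lborel (f (1/6))"
    by simp
  then show ?thesis
    unfolding f_def mordell_int_def by (simp only: distrib_right mult.assoc)
qed

text \<open>The kernel decompositions are integrated term by term against the dual Gaussian. The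
  last two right-hand sides are grouped as P - sqrt 3 Q and P + sqrt 3 Q with the same P and Q, so
  that their product is a difference of squares.\<close>

lemma mordell_int_transforms:
  fixes a b :: real
  assumes a: "a > 0" and b: "b > 0" and ab: "a * b = 1 / 36"
  defines "G \<equiv> mordell_int b"
  shows "sqrt a * mordell_int a (1/2) = sqrt 2 / 6 * (G (5/6) + G (1/2) - G (1/6))" (is ?A)
    and "sqrt a * mordell_int a (1/6)
      = cos (pi / 12) / 3 * (G (5/6) + G (1/2) + 2 * G (1/6) - sqrt 3 * (G (1/2) + G (1/6)))" (is ?B)
    and "sqrt a * mordell_int a (5/6)
      = cos (5 * pi / 12) / 3 * (G (5/6) + G (1/2) + 2 * G (1/6) + sqrt 3 * (G (1/2) + G (1/6)))" (is ?C)
proof -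
  have gen: "sqrt a * mordell_int a s = 2 * cos (pi * s / 2) / 6 * (p * G (5/6) + q * G (1/2) + r * G (1/6))"
    if s: "\<bar>s\<bar> < 1" and k: "\<And>x. cosh (pi * x / 6) / (cos (pi * s) + cosh (pi * x / 3)) =
       p * (cosh (pi * (5/6) * x) / cosh (pi * x)) + q * (cosh (pi * (1/2) * x) / cosh (pi * x))
      + r * (cosh (pi * (1/6) * x) / cosh (pi * x))" for s p q r
  proof -
    have "sqrt a * mordell_int a s = (LBINT x. 2 * cos (pi * s / 2) *
        (cosh (pi * x / 6) / (cos (pi * s) + cosh (pi * x / 3)) * exp (- pi * b * x\<^sup>2))) / 6"
      unfolding mordell_int_def gaussian_cosh_div_cosh_transform[OF s a ab] by (simp add: mult.assoc)
    also have "\<dots> = 2 * cos (pi * s / 2) * (LBINT x. (p * (cosh (pi * (5/6) * x) / cosh (pi * x)) + q * (cosh (pi * (1/2) * x) / cosh (pi * x))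
      + r * (cosh (pi * (1/6) * x) / cosh (pi * x))) * exp (- pi * b * x\<^sup>2)) / 6"
      unfolding k integral_mult_right_zero ..
    finally show ?thesis
      unfolding mordell_int_lincomb[OF b] G_def by simp
  qed
  show ?A
    using gen[OF _ transformed_kernels(1)] by (simp add: cos_45)
  show ?B
    using gen[OF _ transformed_kernels(2)] by (simp add: algebra_simps)
  show ?C
    using gen[OF _ transformed_kernels(3)] by (simp add: algebra_simps)
qed

theorem mainTheorem3:
  fixes \<alpha> \<beta> :: real
  assumes "\<alpha> > 0" and "\<beta> > 0" and "\<alpha> * \<beta> = 1 / 36"
  shows "of_real (sqrt \<alpha>) * (mordell_phi \<alpha> (\<i> / 2))\<^sup>2
           - 2 * of_real (sqrt \<alpha>) * mordell_phi \<alpha> (\<i> / 6) * mordell_phi \<alpha> (5 * \<i> / 6)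
       = of_real (sqrt \<beta>) * (mordell_phi \<beta> (\<i> / 2))\<^sup>2
           - 2 * of_real (sqrt \<beta>) * mordell_phi \<beta> (\<i> / 6) * mordell_phi \<beta> (5 * \<i> / 6)"
proof -
  \<comment> \<open>\<open>mordell_int\<close> runs over the whole line, hence the halves; they
    enter the quadratic form only as a common factor 1/4.\<close>
  have phi: "mordell_phi a (\<i> / 2) = of_real (mordell_int a (1/2) / 2)"
    "mordell_phi a (\<i> / 6) = of_real (mordell_int a (1/6) / 2)"
    "mordell_phi a (5 * \<i> / 6) = of_real (mordell_int a (5/6) / 2)" if "a > 0" for a
    using mordell_phi_imaginary[OF _ that, of "1/2"] mordell_phi_imaginary[OF _ that, of "1/6"]
      mordell_phi_imaginary[OF _ that, of "5/6"]
    by (simp_all add: mordell_int_def mult.commute)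
  define A B where "A = mordell_int \<alpha>" and "B = mordell_int \<beta>"
  define u v where "u = sqrt \<alpha>" and "v = sqrt \<beta>"
  define p q where "p = B (5/6) + B (1/2) + 2 * B (1/6)" and "q = B (1/2) + B (1/6)"
  have uv: "u * v = 1 / 6"
  proof -
    have "u * v = sqrt (1 / 36)"
      unfolding u_def v_def real_sqrt_mult[symmetric] assms(3) ..
    also have "\<dots> = 1 / 6"
      by (rule real_sqrt_unique) (auto simp: power2_eq_square)
    finally show ?thesis .
  qed
  \<comment> \<open>The product is (cos (pi/3) + cos (pi/2)) / 2. It combines the prefactors of the
    transforms at 1/6 and 5/6.\<close>
  have cc: "cos (pi / 12) * cos (5 * pi / 12) = 1 / 4"
    using cos_times_cos[of "pi / 12" "5 * pi / 12"] cos_minus[of "pi / 3"] by (simp add: cos_60)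
  note T = mordell_int_transforms[OF assms, folded A_def B_def u_def, folded p_def q_def]
  have "(u * A (1/2))\<^sup>2 = (B (5/6) + B (1/2) - B (1/6))\<^sup>2 / 18"
    unfolding T by (simp add: power_mult_distrib power_divide)
  moreover have "(u * A (1/6)) * (u * A (5/6)) = (cos (pi / 12) * cos (5 * pi / 12)) / 9 * (p\<^sup>2 - (sqrt 3)\<^sup>2 * q\<^sup>2)"
  proof -
    have "c / 3 * (p - r * q) * (d / 3 * (p + r * q)) = c * d / 9 * (p\<^sup>2 - r\<^sup>2 * q\<^sup>2)" for c d r :: real
      by (simp add: field_simps power2_eq_square)
    then show ?thesis
      unfolding T .
  qed
  then have "(u * A (1/6)) * (u * A (5/6)) = (p\<^sup>2 - 3 * q\<^sup>2) / 36"
    unfolding cc by simp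
  \<comment> \<open>With x, y, z for B (5/6), B (1/2), B (1/6), this is (x + y - z)^2 - (x + y +
    2z)^2 + 3 (y + z)^2 = 3 y^2 - 6 x z, divided by 18.\<close>
  ultimately have key: "(u * A (1/2))\<^sup>2 - 2 * ((u * A (1/6)) * (u * A (5/6))) = (B (1/2))\<^sup>2 / 6 - B (1/6) * B (5/6) / 3"
    by (simp add: p_def q_def field_simps power2_eq_square)
  \<comment> \<open>The form in \<open>key\<close> carries the factor u^2, and u v = 1/6 gives u = 6
    v u^2. The 6 then cancels the 1/6 in \<open>key\<close>, leaving the same form with
    \<open>v\<close> and \<open>B\<close>.\<close>
  have "u * (A (1/2))\<^sup>2 - 2 * u * A (1/6) * A (5/6) = 6 * v * ((u * A (1/2))\<^sup>2 - 2 * ((u * A (1/6)) * (u * A (5/6))))"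
    using uv by algebra
  also have "\<dots> = v * (B (1/2))\<^sup>2 - 2 * v * B (1/6) * B (5/6)"
    unfolding key by (simp add: field_simps)
  finally have "u * (A (1/2) / 2)\<^sup>2 - 2 * u * (A (1/6) / 2) * (A (5/6) / 2)
      = v * (B (1/2) / 2)\<^sup>2 - 2 * v * (B (1/6) / 2) * (B (5/6) / 2)"
    by (simp add: power_divide)
  then have "(of_real (u * (A (1/2) / 2)\<^sup>2 - 2 * u * (A (1/6) / 2) * (A (5/6) / 2)) :: complex)
      = of_real (v * (B (1/2) / 2)\<^sup>2 - 2 * v * (B (1/6) / 2) * (B (5/6) / 2))"
    by (rule arg_cong)
  then show ?thesis
    unfolding phi[OF assms(1)] phi[OF assms(2)] A_def[symmetric] B_def[symmetric] u_def[symmetric] v_def[symmetric]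
    by (simp only: of_real_diff of_real_mult of_real_power of_real_numeral)
qed

end
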